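(* Let $V$ be a simple vertex operator algebra and let $G$ be a finite nilpotent group acting faithfully as automorphisms of $V$ (i.e. $G\le\mathrm{Aut}(V)$). Then the map $H\mapsto V^H$ gives a Galois correspondence between subgroups of $G$ and sub vertex operator algebras of $V$ which contain $V^G$; that is, it is an inclusion-reversing bijection from the set of subgroups of $G$ onto the set of sub VOAs $W$ with $V^G\subseteq W\subseteq V$.
   Context: All spaces are over $\mathbb C$. A vertex operator algebra (VOA) $(V,Y,\mathbf 1,\omega)$ is understood in the standard sense: $V=\bigoplus_{n\in\mathbb Z}V_n$, $\dim V_n<\infty$, $V_n=0$ for $n$ sufficiently small, $Y(v,z)=\sum_{n\in\mathbb Z}v_nz^{-n-1}$, Jacobi identity, vacuum $\mathbf 1$, Virasoro vector $\omega$ with $Y(\omega,z)=\sum_n L(n)z^{-n-2}$, $V_n$ the $n$-eigenspace of $L(0)$, rank in $\mathbb Q$. $V$ is simple if it is simple as a module over itself. $\mathrm{Aut}(V)$ is the group of linear automorphisms $g$ of $V$ with $gY(v,z)g^{-1}=Y(gv,z)$, $g\mathbf 1=\mathbf 1$, $g\omega=\omega$. For $H\le G$, $V^H$ is the sub-VOA of $H$-fixed vectors. A sub VOA of $V$ containing $V^G$ is a subspace $W\supseteq V^G$ (hence containing $\mathbf 1$ and $\omega$) such that $u_nw\in W$ for all $u,w\in W$, $n\in\mathbb Z$. *)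

theory Defs
  imports Complex_Main "HOL-Library.Groups_Big_Fun" "HOL-Algebra.Generated_Groups"
begin

section \<open>Nilpotent groups\<close>

primrec lower_central_series :: "('a, 'b) monoid_scheme \<Rightarrow> nat \<Rightarrow> 'a set" where
  "lower_central_series G 0 = carrier G"
| "lower_central_series G (Suc k) =
     generate G {x \<otimes>\<^bsub>G\<^esub> y \<otimes>\<^bsub>G\<^esub> inv\<^bsub>G\<^esub> x \<otimes>\<^bsub>G\<^esub> inv\<^bsub>G\<^esub> y | x y.
                   x \<in> carrier G \<and> y \<in> lower_central_series G k}"

definition nilpotent_group :: "('a, 'b) monoid_scheme \<Rightarrow> bool" where
  "nilpotent_group G \<longleftrightarrow> group G \<and> (\<exists>k. lower_central_series G k = {\<one>\<^bsub>G\<^esub>})"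

section \<open>Vertex operator algebras\<close>

text \<open>
  The underlying space is the whole type \<open>'v\<close> with complex scalar multiplication \<open>scale\<close>.
  A vertex operator is given by its modes: \<open>Y u n w\<close> is \<open>u\<^sub>n w\<close>, where
  \<open>Y(u,z) = \<Sum>\<^sub>n u\<^sub>n z\<^sup>-\<^sup>n\<^sup>-\<^sup>1\<close>.  In particular \<open>L(n) = \<omega>\<^sub>n\<^sub>+\<^sub>1\<close>.

  The assumption \<open>Jacobi\<close> equates the coefficients of
  \<open>x\<^sup>-\<^sup>l\<^sup>-\<^sup>1 y\<^sup>-\<^sup>m\<^sup>-\<^sup>1 z\<^sup>-\<^sup>n\<^sup>-\<^sup>1\<close> in the Jacobi identity
  \<open>z\<^sup>-\<^sup>1 \<delta>((y-x)/z) Y(Y(u,x)v,z)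
     = x\<^sup>-\<^sup>1 \<delta>((y-z)/x) Y(u,y)Y(v,z) - x\<^sup>-\<^sup>1 \<delta>((z-y)/(-x)) Y(v,z)Y(u,y)\<close>,
  applied to \<open>w\<close>.  By \<open>truncation\<close> each sum has only finitely many nonzero terms.
\<close>

locale vertex_operator_algebra = vector_space scale
  for scale :: "complex \<Rightarrow> 'v::ab_group_add \<Rightarrow> 'v" +
  fixes Y :: "'v \<Rightarrow> int \<Rightarrow> 'v \<Rightarrow> 'v"
    and vac :: 'v
    and \<omega> :: 'v
  assumes linear_left: "\<And>n w. Vector_Spaces.linear scale scale (\<lambda>u. Y u n w)"
    and linear_right: "\<And>u n. Vector_Spaces.linear scale scale (Y u n)"
    and truncation: "\<And>u w. \<exists>N. \<forall>n\<ge>N. Y u n w = 0"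
    and vacuum: "\<And>n w. Y vac n w = (if n = - 1 then w else 0)"
    and creation_regular: "\<And>u n. n \<ge> 0 \<Longrightarrow> Y u n vac = 0"
    and creation: "\<And>u. Y u (- 1) vac = u"
    and Jacobi: "\<And>u v w l m n.
      Sum_any (\<lambda>i::nat. scale (of_int m gchoose i) (Y (Y u (l + int i) v) (m + n - int i) w)) =
      Sum_any (\<lambda>i::nat. scale ((- 1) ^ i * (of_int l gchoose i))
         (Y u (m + l - int i) (Y v (n + int i) w)
          - scale ((- 1) powi l) (Y v (n + l - int i) (Y u (m + int i) w))))"
    and Virasoro: "\<exists>c::rat. \<forall>m n w.
      Y \<omega> (m + 1) (Y \<omega> (n + 1) w) - Y \<omega> (n + 1) (Y \<omega> (m + 1) w) =
      scale (of_int (m - n)) (Y \<omega> (m + n + 1) w)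
      + (if m + n = 0 then scale (of_int (m ^ 3 - m) / 12 * of_rat c) w else 0)"
    and derivative: "\<And>u n w. Y (Y \<omega> 0 u) n w = scale (- of_int n) (Y u (n - 1) w)"
    and grading_direct_sum:
      "\<And>v. \<exists>!f. (\<forall>n::int. Y \<omega> 1 (f n) = scale (of_int n) (f n)) \<and>
                finite {n. f n \<noteq> 0} \<and> v = Sum_any f"
    and grading_finite_dim:
      "\<And>n::int. \<exists>B. finite B \<and> {v. Y \<omega> 1 v = scale (of_int n) v} \<subseteq> span B"
    and grading_bounded_below:
      "\<exists>N::int. \<forall>n<N. {v. Y \<omega> 1 v = scale (of_int n) v} = {0}"
begin

definition submodule :: "'v set \<Rightarrow> bool" where
  "submodule W \<longleftrightarrow> subspace W \<and> (\<forall>u n. \<forall>w\<in>W. Y u n w \<in> W)"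

definition simple_VOA :: bool where
  "simple_VOA \<longleftrightarrow> (UNIV :: 'v set) \<noteq> {0} \<and> (\<forall>W. submodule W \<longrightarrow> W = {0} \<or> W = UNIV)"

definition Aut :: "('v \<Rightarrow> 'v) monoid" where
  "Aut = \<lparr>carrier = {g. Vector_Spaces.linear scale scale g \<and> bij g \<and>
                        (\<forall>v n. g \<circ> Y v n \<circ> inv_into UNIV g = Y (g v) n) \<and>
                        g vac = vac \<and> g \<omega> = \<omega>},
          mult = (\<circ>), one = id\<rparr>"

text \<open>Any \<open>W\<close> as below contains \<open>vac\<close> and \<open>\<omega>\<close> when \<open>U\<close> does, e.g. when \<open>U\<close> is the
  fixed-point space of a set of automorphisms.\<close>

definition sub_VOA_containing :: "'v set \<Rightarrow> 'v set \<Rightarrow> bool" where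
  "sub_VOA_containing U W \<longleftrightarrow> subspace W \<and> U \<subseteq> W \<and> (\<forall>u\<in>W. \<forall>w\<in>W. \<forall>n. Y u n w \<in> W)"

end

definition fixed_points :: "('v \<Rightarrow> 'v) set \<Rightarrow> 'v set" where
  "fixed_points H = {v. \<forall>h\<in>H. h v = v}"

end

theory Submission
  imports Defs "HOL-Computational_Algebra.Fundamental_Theorem_Algebra"
begin

text \<open>
  Since \<open>V\<close> is simple, Jacobson density with Schur's lemma gives: every linear map \<open>T\<close> agrees on any
  given finite set with a sum of modes.  Averaging such a sum over \<open>G\<close> gives a sum of modes of elements
  of \<open>V\<^sup>G\<close>, so every \<open>V\<^sup>G\<close>-stable subspace \<open>W\<close> contains \<open>\<Sum>\<^sub>g g\<inverse> T (g w)\<close> for all \<open>w \<in> W\<close>.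
  If \<open>W\<close> is closed under all products, then weak commutativity and density together show that the
  matrix coefficients \<open>g \<mapsto> f (g w)\<close> of \<open>W\<close> are closed under pointwise multiplication.  They separate
  the cosets of the stabiliser \<open>H\<close> of \<open>W\<close>, so the indicator function of \<open>H\<close> is such a coefficient sum,
  and averaging it against \<open>v \<in> V\<^sup>H\<close> gives \<open>|H| v \<in> W\<close>.  Injectivity of \<open>H \<mapsto> V\<^sup>H\<close> follows from the
  case \<open>W = V\<close>.
\<close>

section \<open>Eigenvectors\<close>

text \<open>A root \<open>z\<close> splits off as \<open>p = [:-z, 1:] * q\<close>, so
  \<open>T - z\<close> kills \<open>q(T) v\<close>. Either this vector is a nonzero eigenvector, or
  it vanishes and \<open>q\<close> takes the place of \<open>p\<close> in the induction.\<close>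

lemma linear_poly_kernel_eigenvector:
  fixes scale :: "complex \<Rightarrow> 'v::ab_group_add \<Rightarrow> 'v"
  assumes lin: "Vector_Spaces.linear scale scale T"
    and "p \<noteq> 0" "v \<noteq> 0" "degree p \<le> N"
    and "(\<Sum>i\<le>N. scale (coeff p i) ((T ^^ i) v)) = 0"
  shows "\<exists>c x. x \<noteq> 0 \<and> T x = scale c x"
  using assms(2-)
proof (induction N arbitrary: p)
  case 0
  interpret vector_space_pair scale scale
    using lin by (simp add: Vector_Spaces.linear_def vector_space_pair_def)
  from 0 show ?case
    by (auto dest: degree0_coeffs)
next
  case (Suc N)
  interpret vector_space_pair scale scale
    using lin by (simp add: Vector_Spaces.linear_def vector_space_pair_def)
  show ?case
  proof (cases "degree p = 0")
    case True
    then have "coeff p i = 0" if "i \<noteq> 0" for i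
      using that by (simp add: coeff_eq_0)
    then have "(\<Sum>i\<le>Suc N. scale (coeff p i) ((T ^^ i) v)) = (\<Sum>i\<in>{0}. scale (coeff p i) ((T ^^ i) v))"
      by (intro sum.mono_neutral_right) auto
    with Suc.prems True show ?thesis
      by (auto dest: degree0_coeffs)
  next
    case False
    then obtain z where "poly p z = 0"
      using fundamental_theorem_of_algebra[of p] constant_degree[of p] by auto
    then obtain q where p: "p = [:-z, 1:] * q"
      by (auto simp: poly_eq_0_iff_dvd dvd_def)
    have "q \<noteq> 0" using p Suc.prems by auto
    have deg: "degree q \<le> N"
      using Suc.prems(3) \<open>q \<noteq> 0\<close> unfolding p by (subst (asm) degree_mult_eq) auto
    define x where "x = (\<Sum>i\<le>N. scale (coeff q i) ((T ^^ i) v))"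
    have co: "coeff p i = (case i of 0 \<Rightarrow> 0 | Suc j \<Rightarrow> coeff q j) - z * coeff q i" for i
      unfolding p by (simp add: coeff_pCons split: nat.split)
    have "(\<Sum>i\<le>Suc N. scale (coeff p i) ((T ^^ i) v)) =
      (\<Sum>i\<le>Suc N. scale (case i of 0 \<Rightarrow> 0 | Suc j \<Rightarrow> coeff q j) ((T ^^ i) v))
       - (\<Sum>i\<le>Suc N. scale z (scale (coeff q i) ((T ^^ i) v)))"
      by (simp only: co vs1.scale_left_diff_distrib sum_subtractf vs1.scale_scale)
    also have "(\<Sum>i\<le>Suc N. scale (case i of 0 \<Rightarrow> 0 | Suc j \<Rightarrow> coeff q j) ((T ^^ i) v)) = T x"
      by (subst sum.atMost_Suc_shift) (simp add: x_def linear_sum[OF lin] linear_scale[OF lin])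
    also have "(\<Sum>i\<le>Suc N. scale z (scale (coeff q i) ((T ^^ i) v))) = scale z x"
      using deg by (simp add: x_def vs1.scale_sum_right coeff_eq_0)
    finally have "T x = scale z x"
      using Suc.prems by simp
    moreover have ?thesis if "x = 0"
      using Suc.IH[OF \<open>q \<noteq> 0\<close> \<open>v \<noteq> 0\<close> deg] that unfolding x_def .
    ultimately show ?thesis
      by blast
  qed
qed

text \<open>The first \<open>card B + 1\<close> iterates of \<open>v\<close> stay in
  \<open>S\<close>, so they satisfy a linear relation, which is a nonzero polynomial in
  \<open>T\<close> killing \<open>v\<close>.\<close>

lemma linear_invariant_finite_dim_eigenvector:
  fixes scale :: "complex \<Rightarrow> 'v::ab_group_add \<Rightarrow> 'v"
  assumes lin: "Vector_Spaces.linear scale scale T"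
    and B: "finite B" "S \<subseteq> module.span scale B"
    and v: "v \<in> S" "v \<noteq> 0" and inv: "T ` S \<subseteq> S"
  shows "\<exists>c x. x \<noteq> 0 \<and> T x = scale c x"
proof -
  interpret vector_space_pair scale scale
    using lin by (simp add: Vector_Spaces.linear_def vector_space_pair_def)
  define N where "N = card B"
  define t where "t i = (T ^^ i) v" for i
  have tS: "t i \<in> S" for i
    unfolding t_def by (induction i) (use v inv in auto)
  have "\<exists>c. (\<exists>i\<le>N. c i \<noteq> 0) \<and> (\<Sum>i\<le>N. scale (c i) (t i)) = 0"
  \<comment> \<open>Dependence of the set of iterates gives a relation between indices only if the
    iterates are distinct; two equal iterates are a relation by themselves.\<close>
  proof (cases "inj_on t {..N}")
    case True
    have "card (t ` {..N}) = Suc N"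
      using True by (simp add: card_image)
    then have "vs1.dependent (t ` {..N})"
      using vs1.independent_span_bound[OF B(1), of "t ` {..N}"] tS B(2) by (fastforce simp: N_def)
    then obtain u where "\<exists>x\<in>t ` {..N}. u x \<noteq> 0" "(\<Sum>x\<in>t ` {..N}. scale (u x) x) = 0"
      by (auto simp: vs1.dependent_finite)
    then show ?thesis
      using True by (intro exI[of _ "u \<circ> t"]) (auto simp: sum.reindex)
  next
    case False
    then obtain i j where ij: "i \<le> N" "j \<le> N" "i \<noteq> j" "t i = t j"
      by (auto simp: inj_on_def)
    define c :: "nat \<Rightarrow> complex" where "c k = (if k = i then 1 else if k = j then - 1 else 0)" for k
    have "(\<Sum>k\<le>N. scale (c k) (t k)) = (\<Sum>k\<in>{i, j}. scale (c k) (t k))"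
      using ij by (intro sum.mono_neutral_right) (auto simp: c_def)
    also have "\<dots> = 0"
      using ij by (simp add: c_def)
    finally show ?thesis
      using ij by (intro exI[of _ c]) (auto simp: c_def)
  qed
  then obtain c where c: "\<exists>i\<le>N. c i \<noteq> 0" "(\<Sum>i\<le>N. scale (c i) (t i)) = 0"
    by blast
  define p where "p = (\<Sum>i\<le>N. monom (c i) i)"
  have co: "coeff p k = (if k \<le> N then c k else 0)" for k
    by (simp add: p_def coeff_sum)
  show ?thesis
  proof (rule linear_poly_kernel_eigenvector[OF lin _ v(2)])
    show "p \<noteq> 0" using c(1) co by (metis coeff_0)
    show "degree p \<le> N" by (rule degree_le) (simp add: co)
    show "(\<Sum>i\<le>N. scale (coeff p i) ((T ^^ i) v)) = 0"
      using c(2) by (simp add: co t_def)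
  qed
qed

section \<open>Density of the operators spanned by modes\<close>

context vertex_operator_algebra
begin

sublocale endo: vector_space_pair scale scale ..

lemmas Y_left_simps =
  endo.linear_0[OF linear_left] endo.linear_add[OF linear_left] endo.linear_diff[OF linear_left]
  endo.linear_scale[OF linear_left] endo.linear_sum[OF linear_left]

lemmas Y_right_simps =
  endo.linear_0[OF linear_right] endo.linear_add[OF linear_right] endo.linear_diff[OF linear_right]
  endo.linear_scale[OF linear_right] endo.linear_sum[OF linear_right]

text \<open>Closure under addition already gives the linear span, since a scalar can be absorbed
  into \<open>u\<close>.\<close>

inductive mode_sum :: "('v \<Rightarrow> 'v) \<Rightarrow> bool" where
  mode: "mode_sum (Y u n)"
| add: "mode_sum a \<Longrightarrow> mode_sum b \<Longrightarrow> mode_sum (\<lambda>x. a x + b x)"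

lemma mode_sum_linear: "mode_sum a \<Longrightarrow> Vector_Spaces.linear scale scale a"
  by (induction rule: mode_sum.induct) (simp_all add: linear_right endo.linear_compose_add)

lemma mode_sum_zero: "mode_sum (\<lambda>x. 0)"
proof -
  have "Y 0 0 = (\<lambda>x. 0)"
    by (simp add: fun_eq_iff Y_left_simps)
  then show ?thesis
    using mode_sum.mode by metis
qed

lemma mode_sum_id: "mode_sum (\<lambda>x. x)"
proof -
  have "Y vac (- 1) = (\<lambda>x. x)"
    by (simp add: vacuum fun_eq_iff)
  then show ?thesis
    using mode_sum.mode by metis
qed

lemma mode_sum_scale: "mode_sum a \<Longrightarrow> mode_sum (\<lambda>x. scale c (a x))"
proof (induction rule: mode_sum.induct)
  case (mode u n)
  have "Y (scale c u) n = (\<lambda>x. scale c (Y u n x))"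
    by (simp add: fun_eq_iff Y_left_simps)
  then show ?case
    using mode_sum.mode by metis
next
  case (add a b)
  then show ?case
    by (simp add: scale_right_distrib mode_sum.add)
qed

lemma mode_sum_diff: "mode_sum a \<Longrightarrow> mode_sum b \<Longrightarrow> mode_sum (\<lambda>x. a x - b x)"
  using mode_sum.add[of a "\<lambda>x. scale (- 1) (b x)"] mode_sum_scale[of b "- 1"] by simp

lemma mode_sum_sum: "(\<And>i. i \<in> I \<Longrightarrow> mode_sum (a i)) \<Longrightarrow> mode_sum (\<lambda>x. \<Sum>i\<in>I. a i x)"
  by (induction I rule: infinite_finite_induct) (simp_all add: mode_sum_zero mode_sum.add)

lemma truncation_uniform:
  assumes "finite P"
  shows "\<exists>N. \<forall>(u, w)\<in>P. \<forall>n\<ge>N. Y u n w = 0"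
  using assms
proof (induction P rule: finite_induct)
  case (insert q P)
  then obtain N where N: "\<forall>(u, w)\<in>P. \<forall>n\<ge>N. Y u n w = 0"
    by blast
  obtain u w where q: "q = (u, w)"
    by (cases q)
  obtain M where "\<forall>n\<ge>M. Y u n w = 0"
    using truncation by blast
  with N q show ?case
    by (intro exI[of _ "max M N"]) auto
qed auto

text \<open>The Jacobi identity with \<open>l = p - m\<close>; the choice of \<open>m\<close> makes the term with \<open>a\<close> acting first vanish.\<close>

lemma Y_mode_Y:
  assumes a: "\<forall>k\<ge>m. Y a k x = 0" and u: "\<forall>k\<ge>K. Y u k x = 0" and au: "\<forall>k\<ge>L. Y a k u = 0"
  shows "Y a p (Y u n x) =
    (\<Sum>i<nat (L - (p - m)). scale (of_int m gchoose i) (Y (Y a (p - m + int i) u) (m + n - int i) x))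
    - (\<Sum>i\<in>{1..<Suc (nat (K - n))}.
         scale ((- 1) ^ i * (of_int (p - m) gchoose i)) (Y a (p - int i) (Y u (n + int i) x)))"
proof -
  define l where "l = p - m"
  \<comment> \<open>The \<open>Suc\<close> keeps the index 0 in the range even when
    \<open>K \<le> n\<close>, so that \<open>Y a p (Y u n x)\<close> can always be split
    off.\<close>
  define R where "R = Suc (nat (K - n))"
  let ?f = "\<lambda>i::nat. scale (of_int m gchoose i) (Y (Y a (l + int i) u) (m + n - int i) x)"
  let ?h = "\<lambda>i::nat. scale ((- 1) ^ i * (of_int l gchoose i)) (Y a (p - int i) (Y u (n + int i) x))"
  have "Sum_any ?f = (\<Sum>i<nat (L - l). ?f i)"
    by (rule Sum_any.expand_superset) (use au in \<open>auto simp: Y_left_simps not_le intro: ccontr\<close>)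
  moreover have "Sum_any (\<lambda>i::nat. scale ((- 1) ^ i * (of_int l gchoose i))
         (Y a (m + l - int i) (Y u (n + int i) x)
          - scale ((- 1) powi l) (Y u (n + l - int i) (Y a (m + int i) x)))) = Sum_any ?h"
    by (rule arg_cong[where f = Sum_any]) (use a in \<open>simp add: fun_eq_iff Y_right_simps l_def\<close>)
  moreover have "Sum_any ?h = (\<Sum>i<R. ?h i)"
    by (rule Sum_any.expand_superset)
       (use u in \<open>auto simp: Y_right_simps R_def not_le intro: ccontr\<close>)
  moreover have "(\<Sum>i<R. ?h i) = Y a p (Y u n x) + (\<Sum>i\<in>{1..<R}. ?h i)"
    using sum.atLeast_Suc_lessThan[of 0 R ?h] by (simp add: R_def lessThan_atLeast0)
  ultimately show ?thesis
    using Jacobi[of m a l u n x] unfolding l_def[symmetric] R_def[symmetric] by (simp add: algebra_simps)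
qed

text \<open>On a finite set the truncation bounds are uniform, so \<open>Y_mode_Y\<close> applies
  with the same coefficients at every point. This lets the span of the modes stand in for the
  algebra they generate.\<close>

lemma Y_mode_sum_on_finite:
  assumes "mode_sum b" and F: "finite F"
  shows "\<exists>b'. mode_sum b' \<and> (\<forall>x\<in>F. Y a p (b x) = b' x)"
  using assms(1)
proof (induction rule: mode_sum.induct)
  case (mode u n)
  obtain m where m: "\<forall>x\<in>F. \<forall>k\<ge>m. Y a k x = 0"
    using truncation_uniform[of "{a} \<times> F"] F by auto
  obtain K where K: "\<forall>x\<in>F. \<forall>k\<ge>K. Y u k x = 0"
    using truncation_uniform[of "{u} \<times> F"] F by auto
  obtain L where L: "\<forall>k\<ge>L. Y a k u = 0"
    using truncation by blast
  show ?case
  \<comment> \<open>The products left over by \<open>Y_mode_Y\<close> have a larger inner index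
    \<open>n + i\<close>; once this reaches \<open>K\<close>, the inner mode kills
    \<open>F\<close>.\<close>
  proof (induction "nat (K - n)" arbitrary: n p rule: less_induct)
    case less
    show ?case
    proof (cases "n < K")
      case True
      have "\<exists>b'. mode_sum b' \<and> (\<forall>x\<in>F. Y a (p - int i) (Y u (n + int i) x) = b' x)" if "i \<ge> 1" for i
        using that True by (intro less) auto
      then obtain b where b: "\<And>i. i \<ge> 1 \<Longrightarrow> mode_sum (b i)"
        "\<And>i x. i \<ge> 1 \<Longrightarrow> x \<in> F \<Longrightarrow> Y a (p - int i) (Y u (n + int i) x) = b i x"
        by metis
      let ?b' = "\<lambda>x. (\<Sum>i<nat (L - (p - m)). scale (of_int m gchoose i)
            (Y (Y a (p - m + int i) u) (m + n - int i) x))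
        - (\<Sum>i\<in>{1..<Suc (nat (K - n))}. scale ((- 1) ^ i * (of_int (p - m) gchoose i)) (b i x))"
      have "mode_sum ?b'"
        using b by (intro mode_sum_diff mode_sum_sum mode_sum_scale mode_sum.mode) auto
      moreover have "Y a p (Y u n x) = ?b' x" if "x \<in> F" for x
        using b(2)[OF _ that] m K L that by (subst Y_mode_Y[where m = m and K = K and L = L]) auto
      ultimately show ?thesis
        by blast
    next
      case False
      then show ?thesis
        using K mode_sum_zero by (intro exI[of _ "\<lambda>x. 0"]) (auto simp: Y_right_simps)
    qed
  qed
next
  case (add b c)
  then obtain b' c' where "mode_sum b'" "mode_sum c'"
    "\<forall>x\<in>F. Y a p (b x) = b' x" "\<forall>x\<in>F. Y a p (c x) = c' x"
    by blast
  then show ?case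
    by (intro exI[of _ "\<lambda>x. b' x + c' x"]) (auto simp: Y_right_simps mode_sum.add)
qed

text \<open>\<open>T\<close> commutes with \<open>L(0)\<close> and so preserves a nonzero weight
  space. This is finite-dimensional and yields an eigenvector, whose eigenspace is a nonzero
  submodule.\<close>

lemma simple_VOA_Schur:
  assumes simple_VOA and lin: "Vector_Spaces.linear scale scale T"
    and comm: "\<And>a p x. T (Y a p x) = Y a p (T x)"
  shows "\<exists>c. \<forall>x. T x = scale c x"
proof -
  obtain w :: 'v where "w \<noteq> 0"
    using \<open>simple_VOA\<close> unfolding simple_VOA_def by blast
  obtain f where f: "\<forall>n::int. Y \<omega> 1 (f n) = scale (of_int n) (f n)" "w = Sum_any f"
    using grading_direct_sum[of w] by blast
  with \<open>w \<noteq> 0\<close> have "f \<noteq> (\<lambda>n. 0)"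
    by (auto simp: Sum_any.neutral)
  then obtain n where n: "f n \<noteq> 0"
    by blast
  let ?S = "{v. Y \<omega> 1 v = scale (of_int n) v}"
  obtain B where "finite B" "?S \<subseteq> span B"
    using grading_finite_dim by blast
  moreover have "T ` ?S \<subseteq> ?S"
    by (auto simp: comm[symmetric] endo.linear_scale[OF lin])
  ultimately obtain c x where x: "x \<noteq> 0" "T x = scale c x"
    using linear_invariant_finite_dim_eigenvector[OF lin, of B ?S "f n"] f(1) n by blast
  have "submodule {x. T x = scale c x}"
    unfolding submodule_def by (auto intro!: subspaceI simp: comm Y_right_simps
        endo.linear_0[OF lin] endo.linear_add[OF lin] endo.linear_scale[OF lin] scale_right_distrib
        scale_left_commute)
  then have "{x. T x = scale c x} = UNIV"
    using \<open>simple_VOA\<close> x unfolding simple_VOA_def by blast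
  then show ?thesis
    by blast
qed

text \<open>The values at \<open>y\<close> of the mode sums vanishing on \<open>X\<close> form a
  submodule, which by simplicity is everything once it is nonzero.\<close>

lemma mode_sum_transitive:
  assumes simple_VOA "finite X" and b: "mode_sum b" "\<forall>x\<in>X. b x = 0" "b y \<noteq> 0"
  shows "\<exists>b. mode_sum b \<and> (\<forall>x\<in>X. b x = 0) \<and> b y = z"
proof -
  let ?J = "{b y | b. mode_sum b \<and> (\<forall>x\<in>X. b x = 0)}"
  have "subspace ?J"
  proof (rule subspaceI)
    show "0 \<in> ?J"
      using mode_sum_zero by fastforce
    show "v + w \<in> ?J" if "v \<in> ?J" "w \<in> ?J" for v w
    proof -
      from that obtain a b where "mode_sum a" "\<forall>x\<in>X. a x = 0" "v = a y"
        "mode_sum b" "\<forall>x\<in>X. b x = 0" "w = b y"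
        by auto
      then show ?thesis
        using mode_sum.add[of a b] by fastforce
    qed
    show "scale c v \<in> ?J" if "v \<in> ?J" for c v
    proof -
      from that obtain a where "mode_sum a" "\<forall>x\<in>X. a x = 0" "v = a y"
        by auto
      then show ?thesis
        using mode_sum_scale[of a c] by fastforce
    qed
  qed
  moreover have "Y a p v \<in> ?J" if v: "v \<in> ?J" for a p v
  proof -
    obtain b where b: "mode_sum b" "\<forall>x\<in>X. b x = 0" "v = b y"
      using v by blast
    \<comment> \<open>Agreement on \<open>insert y X\<close> preserves the vanishing on
      \<open>X\<close> and captures the value at \<open>y\<close>.\<close>
    obtain b' where b': "mode_sum b'" "\<forall>x\<in>insert y X. Y a p (b x) = b' x"
      using Y_mode_sum_on_finite[OF b(1), of "insert y X" a p] \<open>finite X\<close> by blast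
    with b have "\<forall>x\<in>X. b' x = 0" "Y a p v = b' y"
      by (metis Y_right_simps(1) insertCI, simp)
    with b' show ?thesis
      by blast
  qed
  ultimately have "submodule ?J"
    unfolding submodule_def by blast
  then have "?J = UNIV"
    using assms unfolding simple_VOA_def by blast
  then have "z \<in> ?J"
    by simp
  then show ?thesis
    by blast
qed

text \<open>When \<open>x\<close> is added to \<open>X\<close> and separation fails, values at
  \<open>x\<close> determine values at \<open>y\<close> through a map commuting with all modes.
  Schur makes this map a scalar, which forces \<open>y\<close> into the span.\<close>

lemma mode_sum_separates:
  assumes simple_VOA "finite X" "y \<notin> span X"
  shows "\<exists>b. mode_sum b \<and> (\<forall>x\<in>X. b x = 0) \<and> b y \<noteq> 0"
  using assms(2,3)
proof (induction X arbitrary: y rule: finite_induct)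
  case empty
  then show ?case
    using mode_sum_id by auto
next
  case (insert x X)
  show ?case
  proof (cases "x \<in> span X")
    case True
    with insert.prems have "y \<notin> span X"
      by (simp add: span_redundant)
    then obtain b where b: "mode_sum b" "\<forall>x\<in>X. b x = 0" "b y \<noteq> 0"
      using insert.IH by blast
    then have "b x = 0"
      using endo.linear_eq_on[OF mode_sum_linear[OF b(1)] endo.linear_zero True] by auto
    with b show ?thesis
      by blast
  next
    case False
    show ?thesis
    proof (rule ccontr)
      assume "\<not> ?thesis"
      then have kill: "b y = 0" if "mode_sum b" "\<forall>x\<in>X. b x = 0" "b x = 0" for b
        using that by blast
      have "\<exists>b. mode_sum b \<and> (\<forall>x\<in>X. b x = 0) \<and> b x = z" for z
        using insert.IH[OF False] mode_sum_transitive[OF \<open>simple_VOA\<close> insert.hyps(1)] by blast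
      then obtain e where e: "\<And>z. mode_sum (e z)" "\<And>z x'. x' \<in> X \<Longrightarrow> e z x' = 0" "\<And>z. e z x = z"
        by metis
      \<comment> \<open>By \<open>kill\<close>, the choice of \<open>e\<close> does not matter:
        among mode sums vanishing on \<open>X\<close>, the value at \<open>x\<close> determines the
        value at \<open>y\<close>.\<close>
      define T where "T z = e z y" for z
      have T: "T (b x) = b y" if "mode_sum b" "\<forall>x\<in>X. b x = 0" for b
        using kill[OF mode_sum_diff[OF e(1) that(1)], of "b x"] that e unfolding T_def by simp
      have lin: "Vector_Spaces.linear scale scale T"
      proof -
        have "T (u + v) = T u + T v" for u v
          using T[OF mode_sum.add[OF e(1)[of u] e(1)[of v]]] e(2,3) by (simp add: T_def)
        moreover have "T (scale c u) = scale c (T u)" for c u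
          using T[OF mode_sum_scale[OF e(1)[of u]]] e(2,3) by (simp add: T_def)
        ultimately show ?thesis
          using vector_space_axioms by (simp add: Vector_Spaces.linear_iff)
      qed
      have comm: "T (Y a p z) = Y a p (T z)" for a p z
      proof -
        obtain b' where b': "mode_sum b'" "\<forall>w\<in>insert x (insert y X). Y a p (e z w) = b' w"
          using Y_mode_sum_on_finite[OF e(1), of "insert x (insert y X)" a p] \<open>finite X\<close> by blast
        then have "\<forall>w\<in>X. b' w = 0" "b' x = Y a p z" "b' y = Y a p (T z)"
          using e(2,3) by (auto simp: T_def Y_right_simps simp flip: b'(2))
        then show ?thesis
          using T[OF b'(1)] by simp
      qed
      obtain c where c: "\<And>z. T z = scale c z"
        using simple_VOA_Schur[OF \<open>simple_VOA\<close> lin comm] by blast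
      \<comment> \<open>Every mode sum vanishing on \<open>X\<close> also kills this vector, so the
        induction hypothesis applies to it.\<close>
      have "y - scale c x \<in> span X"
      proof (rule ccontr)
        assume "y - scale c x \<notin> span X"
        then obtain b where b: "mode_sum b" "\<forall>x\<in>X. b x = 0" "b (y - scale c x) \<noteq> 0"
          using insert.IH by blast
        then show False
          using T[OF b(1,2)] mode_sum_linear[OF b(1)] by (simp add: c endo.linear_diff endo.linear_scale)
      qed
      with insert.prems show False
        by (auto simp: span_insert)
    qed
  qed
qed

text \<open>Jacobson density, but for the span of the modes rather than the algebra they generate; only
  elements of the span can be averaged over a group of automorphisms mode by mode.\<close>

lemma mode_sum_density:
  assumes simple_VOA "finite F" and lin: "Vector_Spaces.linear scale scale T"
  shows "\<exists>b. mode_sum b \<and> (\<forall>x\<in>F. b x = T x)"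
  using assms(2)
proof (induction F rule: finite_induct)
  case empty
  then show ?case
    using mode_sum_zero by blast
next
  case (insert x F)
  then obtain b where b: "mode_sum b" "\<forall>x\<in>F. b x = T x"
    by blast
  show ?case
  proof (cases "x \<in> span F")
    case True
    then have "b x = T x"
      using endo.linear_eq_on[OF mode_sum_linear[OF b(1)] lin True] b(2) by blast
    with b show ?thesis
      by blast
  next
    case False
    \<comment> \<open>The correction \<open>c\<close> repairs the value at \<open>x\<close> without
      disturbing \<open>F\<close>.\<close>
    then obtain c where "mode_sum c" "\<forall>x\<in>F. c x = 0" "c x = T x - b x"
      using mode_sum_separates mode_sum_transitive \<open>simple_VOA\<close> insert.hyps(1) by metis
    with b show ?thesis
      by (intro exI[of _ "\<lambda>x. b x + c x"]) (auto intro: mode_sum.add)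
  qed
qed

end

section \<open>Averaging over a group of automorphisms\<close>

locale finite_Aut_subgroup = vertex_operator_algebra +
  fixes G :: "('a \<Rightarrow> 'a) set"
  assumes simple: simple_VOA and subgroup_Aut: "subgroup G Aut" and finite_G: "finite G"

section \<open>The automorphism group and its subgroups\<close>

context vertex_operator_algebra
begin

lemma group_Aut: "group Aut"
proof (rule groupI)
  fix f g
  assume f: "f \<in> carrier Aut" and g: "g \<in> carrier Aut"
  show "f \<otimes>\<^bsub>Aut\<^esub> g \<in> carrier Aut"
  proof -
    have bij: "bij f" "bij g"
      using f g by (auto simp: Aut_def)
    have "(f \<circ> g) \<circ> Y v n \<circ> inv_into UNIV (f \<circ> g) = Y ((f \<circ> g) v) n" for v n
    proof -
      have "(f \<circ> g) \<circ> Y v n \<circ> inv_into UNIV (f \<circ> g) = f \<circ> (g \<circ> Y v n \<circ> inv_into UNIV g) \<circ> inv_into UNIV f"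
        using bij by (simp add: o_inv_distrib o_assoc)
      then show ?thesis
        using f g by (simp add: Aut_def)
    qed
    then show ?thesis
      using f g bij by (auto simp: Aut_def bij_comp intro: Vector_Spaces.linear_compose)
  qed
next
  fix f assume f: "f \<in> carrier Aut"
  let ?f' = "inv_into UNIV f"
  have bij: "bij f" and lin: "Vector_Spaces.linear scale scale f"
    and Yf: "f \<circ> Y v n \<circ> ?f' = Y (f v) n" and fixes_vac: "f vac = vac" "f \<omega> = \<omega>" for v n
    using f by (auto simp: Aut_def)
  have inj: "inj f" and inv: "f (?f' x) = x" "?f' (f x) = x" for x
    using bij by (auto simp: bij_def surj_f_inv_f)
  have "?f' \<circ> Y v n \<circ> inv_into UNIV ?f' = Y (?f' v) n" for v n
  proof -
    have "?f' (Y v n (f x)) = Y (?f' v) n x" for x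
      using fun_cong[OF Yf[of "?f' v" n], of "f x"] by (simp add: inv) (metis inv(2))
    then show ?thesis
      using bij by (simp add: inv_inv_eq fun_eq_iff)
  qed
  moreover have "Vector_Spaces.linear scale scale ?f'"
    using lin inv vector_space_axioms by (simp add: Vector_Spaces.linear_iff) (metis inv)
  moreover have "?f' vac = vac" "?f' \<omega> = \<omega>"
    using fixes_vac inv by metis+
  ultimately have "?f' \<in> carrier Aut"
    using bij by (simp add: Aut_def bij_imp_bij_inv)
  moreover have "?f' \<otimes>\<^bsub>Aut\<^esub> f = \<one>\<^bsub>Aut\<^esub>"
    using inv by (simp add: Aut_def fun_eq_iff)
  ultimately show "\<exists>g\<in>carrier Aut. g \<otimes>\<^bsub>Aut\<^esub> f = \<one>\<^bsub>Aut\<^esub>"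
    by blast
qed (auto simp: Aut_def o_assoc linear_id)

lemma inv_Aut:
  assumes "f \<in> carrier Aut"
  shows "inv\<^bsub>Aut\<^esub> f = inv_into UNIV f"
proof -
  interpret group Aut
    by (rule group_Aut)
  have "inv\<^bsub>Aut\<^esub> f \<circ> f = id"
    using l_inv[OF assms] by (simp add: Aut_def)
  moreover have "bij f"
    using assms by (simp add: Aut_def)
  ultimately show ?thesis
    by (metis (no_types) comp_apply ext bij_def id_apply surj_f_inv_f)
qed

text \<open>Translates subgroups of the restricted monoid into closure under composition and
  function inverse, the form used from here on.\<close>

lemma subgroup_Aut_iff:
  assumes G: "subgroup G Aut"
  shows "subgroup H (Aut\<lparr>carrier := G\<rparr>) \<longleftrightarrow>
    H \<subseteq> G \<and> id \<in> H \<and> (\<forall>f\<in>H. \<forall>g\<in>H. f \<circ> g \<in> H) \<and> (\<forall>f\<in>H. inv_into UNIV f \<in> H)"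
proof -
  interpret group Aut
    by (rule group_Aut)
  have "inv\<^bsub>Aut\<lparr>carrier := G\<rparr>\<^esub> f = inv_into UNIV f" if "f \<in> G" for f
    using that m_inv_consistent[OF G] inv_Aut subgroup.subset[OF G] by auto
  moreover have "\<one>\<^bsub>Aut\<^esub> = id" "(\<otimes>\<^bsub>Aut\<^esub>) = (\<circ>)"
    by (simp_all add: Aut_def)
  ultimately show ?thesis
    by (auto simp: subgroup_def subset_iff)
qed

end

section \<open>Sums over subgroups of automorphisms\<close>

context finite_Aut_subgroup
begin

lemma id_in_G: "id \<in> G"
  and comp_in_G: "f \<in> G \<Longrightarrow> g \<in> G \<Longrightarrow> f \<circ> g \<in> G"
  and inv_in_G: "f \<in> G \<Longrightarrow> inv_into UNIV f \<in> G"
proof -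
  interpret group Aut
    by (rule group_Aut)
  have "subgroup G (Aut\<lparr>carrier := G\<rparr>)"
    by (rule subgroup_incl[OF subgroup_Aut subgroup_Aut order_refl])
  then show "id \<in> G" "f \<in> G \<Longrightarrow> g \<in> G \<Longrightarrow> f \<circ> g \<in> G" "f \<in> G \<Longrightarrow> inv_into UNIV f \<in> G"
    by (simp_all add: subgroup_Aut_iff[OF subgroup_Aut])
qed

lemma G_linear: "g \<in> G \<Longrightarrow> Vector_Spaces.linear scale scale g"
  and G_vac: "g \<in> G \<Longrightarrow> g vac = vac"
  and G_bij: "g \<in> G \<Longrightarrow> bij g"
  using subgroup.subset[OF subgroup_Aut] by (auto simp: Aut_def)

lemma G_inv_simp:
  assumes "g \<in> G"
  shows "g (inv_into UNIV g x) = x" "inv_into UNIV g (g x) = x"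
  using G_bij[OF assms] by (simp_all add: bij_def surj_f_inv_f)

lemma G_Y:
  assumes "g \<in> G"
  shows "g (Y u n w) = Y (g u) n (g w)"
proof -
  have "g \<circ> Y u n \<circ> inv_into UNIV g = Y (g u) n"
    using subgroup.subset[OF subgroup_Aut] assms by (auto simp: Aut_def)
  from fun_cong[OF this, of "g w"] show ?thesis
    by (simp add: G_inv_simp(2)[OF assms])
qed

lemma bij_betw_comp_subgroup:
  assumes H: "H \<subseteq> G" "\<And>f g. f \<in> H \<Longrightarrow> g \<in> H \<Longrightarrow> f \<circ> g \<in> H" "\<And>f. f \<in> H \<Longrightarrow> inv_into UNIV f \<in> H"
    and h: "h \<in> H"
  shows "bij_betw ((\<circ>) h) H H"
proof (rule bij_betw_byWitness[where f' = "(\<circ>) (inv_into UNIV h)"])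
  have "h \<in> G"
    using H(1) h by blast
  then show "\<forall>f\<in>H. inv_into UNIV h \<circ> (h \<circ> f) = f" "\<forall>f\<in>H. h \<circ> (inv_into UNIV h \<circ> f) = f"
    by (simp_all add: fun_eq_iff G_inv_simp)
  show "(\<circ>) h ` H \<subseteq> H" "(\<circ>) (inv_into UNIV h) ` H \<subseteq> H"
    using H(2,3) h by blast+
qed

text \<open>Left translation by an element of \<open>H\<close> permutes the summands. The
  elementwise hypotheses cover \<open>G\<close> itself as well as its subgroups.\<close>

lemma sum_subgroup_fixed:
  assumes H: "H \<subseteq> G" "\<And>f g. f \<in> H \<Longrightarrow> g \<in> H \<Longrightarrow> f \<circ> g \<in> H" "\<And>f. f \<in> H \<Longrightarrow> inv_into UNIV f \<in> H"
  shows "(\<Sum>g\<in>H. g u) \<in> fixed_points H"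
  unfolding fixed_points_def
proof safe
  fix h assume h: "h \<in> H"
  have "h (\<Sum>g\<in>H. g u) = (\<Sum>g\<in>H. (h \<circ> g) u)"
    using h H(1) by (simp add: endo.linear_sum[OF G_linear] subset_iff)
  also have "\<dots> = (\<Sum>g\<in>H. g u)"
    by (rule sum.reindex_bij_betw[OF bij_betw_comp_subgroup[OF H h]])
  finally show "h (\<Sum>g\<in>H. g u) = (\<Sum>g\<in>H. g u)" .
qed

lemma sum_inv_G: "(\<Sum>g\<in>G. f (inv_into UNIV g)) = (\<Sum>g\<in>G. f g)"
  by (rule sum.reindex_bij_witness[where i = "inv_into UNIV" and j = "inv_into UNIV"])
     (auto simp: inv_in_G G_bij inv_inv_eq)

end

section \<open>The Galois correspondence\<close>

text \<open>A general \<open>W\<close> serves for surjectivity; the instance \<open>W = UNIV\<close>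
  serves for injectivity.\<close>

locale intermediate_VOA = finite_Aut_subgroup +
  fixes W :: "'a set"
  assumes W: "sub_VOA_containing (fixed_points G) W"
begin

section \<open>Averages over \<open>G\<close> and matrix coefficients of \<open>W\<close>\<close>

lemma subspace_W: "subspace W"
  and fixed_points_subset_W: "fixed_points G \<subseteq> W"
  and Y_in_W: "u \<in> W \<Longrightarrow> w \<in> W \<Longrightarrow> Y u n w \<in> W"
  using W unfolding sub_VOA_containing_def by auto

lemma vac_in_W: "vac \<in> W"
  using fixed_points_subset_W G_vac by (auto simp: fixed_points_def)

lemma vac_nonzero: "vac \<noteq> 0"
proof
  assume "vac = 0"
  then have "u = 0" for u :: 'a
    using creation[of u] by (simp add: Y_right_simps)
  then show False
    using simple unfolding simple_VOA_def by auto
qed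

text \<open>Conjugating a mode by \<open>g\<close> moves \<open>g\<close> onto its vector, so the
  average of a mode of \<open>u\<close> is the same mode of the sum of the orbit of
  \<open>u\<close>, a vector of \<open>fixed_points G \<subseteq> W\<close>.\<close>

lemma average_mode_sum_in_W:
  assumes "mode_sum b" "w \<in> W"
  shows "(\<Sum>g\<in>G. inv_into UNIV g (b (g w))) \<in> W"
  using assms(1)
proof (induction rule: mode_sum.induct)
  case (mode u n)
  have "(\<Sum>g\<in>G. inv_into UNIV g (Y u n (g w))) = (\<Sum>g\<in>G. Y (inv_into UNIV g u) n w)"
    by (intro sum.cong) (simp_all add: G_Y inv_in_G G_inv_simp)
  also have "\<dots> = Y (\<Sum>g\<in>G. g u) n w"
    by (simp add: Y_left_simps sum_inv_G[of "\<lambda>g. Y (g u) n w"])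
  also have "\<dots> \<in> W"
    using sum_subgroup_fixed[OF order_refl comp_in_G inv_in_G] fixed_points_subset_W assms(2)
    by (intro Y_in_W) auto
  finally show ?case .
next
  case (add a b)
  have "(\<Sum>g\<in>G. inv_into UNIV g (a (g w) + b (g w))) =
    (\<Sum>g\<in>G. inv_into UNIV g (a (g w))) + (\<Sum>g\<in>G. inv_into UNIV g (b (g w)))"
    by (simp add: endo.linear_add[OF G_linear] inv_in_G flip: sum.distrib)
  with add show ?case
    by (simp add: subspace_add[OF subspace_W])
qed

text \<open>The functions \<open>G \<rightarrow> V\<close> of the form \<open>g \<mapsto> \<Sum>\<^sub>i T\<^sub>i (g w\<^sub>i)\<close> with \<open>w\<^sub>i \<in> W\<close> and \<open>T\<^sub>i\<close> linear,
  i.e. the tensor product of \<open>V\<close> with the matrix coefficients of \<open>W\<close>.  Values outside \<open>G\<close> are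
  irrelevant.\<close>

inductive orbit_fun :: "(('a \<Rightarrow> 'a) \<Rightarrow> 'a) \<Rightarrow> bool" where
  translate: "w \<in> W \<Longrightarrow> Vector_Spaces.linear scale scale T \<Longrightarrow> orbit_fun (\<lambda>g. T (g w))"
| plus: "orbit_fun \<kappa> \<Longrightarrow> orbit_fun \<mu> \<Longrightarrow> orbit_fun (\<lambda>g. \<kappa> g + \<mu> g)"
| agree: "orbit_fun \<kappa> \<Longrightarrow> (\<And>g. g \<in> G \<Longrightarrow> \<mu> g = \<kappa> g) \<Longrightarrow> orbit_fun \<mu>"

lemma orbit_fun_linear:
  assumes T: "Vector_Spaces.linear scale scale T" and "orbit_fun \<kappa>"
  shows "orbit_fun (\<lambda>g. T (\<kappa> g))"
  using assms(2)
proof (induction rule: orbit_fun.induct)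
  case (translate w S)
  show ?case
    using orbit_fun.translate[OF translate(1) Vector_Spaces.linear_compose[OF translate(2) T]]
    unfolding o_def .
next
  case (plus \<kappa> \<mu>)
  show ?case
    unfolding endo.linear_add[OF T] by (rule orbit_fun.plus[OF plus.IH])
next
  case (agree \<kappa> \<mu>)
  show ?case
    by (rule orbit_fun.agree[OF agree.IH]) (simp add: agree.hyps)
qed

lemma orbit_fun_scale: "orbit_fun \<kappa> \<Longrightarrow> orbit_fun (\<lambda>g. scale c (\<kappa> g))"
  using orbit_fun_linear[of "scale c"] by (simp add: linear_scale_self)

lemma orbit_fun_diff:
  assumes "orbit_fun \<kappa>" "orbit_fun \<mu>"
  shows "orbit_fun (\<lambda>g. \<kappa> g - \<mu> g)"
  using orbit_fun.plus[OF assms(1) orbit_fun_scale[OF assms(2), of "- 1"]] by simp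

lemma orbit_fun_zero: "orbit_fun (\<lambda>g. 0)"
  using orbit_fun.translate[OF vac_in_W endo.linear_zero] .

lemma orbit_fun_sum: "(\<And>i. i \<in> I \<Longrightarrow> orbit_fun (\<kappa> i)) \<Longrightarrow> orbit_fun (\<lambda>g. \<Sum>i\<in>I. \<kappa> i g)"
  by (induction I rule: infinite_finite_induct) (simp_all add: orbit_fun_zero orbit_fun.plus)

text \<open>Only the finitely many values \<open>T (g w)\<close> enter the sum, so density replaces
  \<open>T\<close> by a mode sum.\<close>

lemma average_orbit_fun_in_W:
  assumes "orbit_fun \<kappa>"
  shows "(\<Sum>g\<in>G. inv_into UNIV g (\<kappa> g)) \<in> W"
  using assms
proof (induction rule: orbit_fun.induct)
  case (translate w T)
  obtain b where b: "mode_sum b" "\<forall>x\<in>(\<lambda>g. g w) ` G. b x = T x"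
    using mode_sum_density[OF simple finite_imageI[OF finite_G] translate(2)] by blast
  have "(\<Sum>g\<in>G. inv_into UNIV g (T (g w))) = (\<Sum>g\<in>G. inv_into UNIV g (b (g w)))"
    using b(2) by (intro sum.cong) auto
  then show ?case
    using average_mode_sum_in_W[OF b(1) translate(1)] by simp
next
  case (plus \<kappa> \<mu>)
  then show ?case
    by (simp add: endo.linear_add[OF G_linear] inv_in_G sum.distrib subspace_add[OF subspace_W])
next
  case (agree \<kappa> \<mu>)
  then show ?case
    by simp
qed

text \<open>Weak commutativity moves \<open>a\<close> to the left of \<open>g w\<close>, and \<open>(g w)\<^sub>p (g w') = g (w\<^sub>p w')\<close>.\<close>

lemma orbit_fun_Y_Y:
  assumes w: "w \<in> W" "w' \<in> W"
  shows "orbit_fun (\<lambda>g. Y (g w) p (Y a m (g w')))"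
proof -
  obtain N0 where N0: "\<forall>g\<in>G. \<forall>k\<ge>N0. Y (g w) k a = 0"
    using truncation_uniform[of "(\<lambda>g. (g w, a)) ` G"] finite_G by auto
  define N where "N = nat N0"
  have N: "Y (g w) (int N + int i) a = 0" if "g \<in> G" for g i
    using N0 that by (auto simp: N_def)
  obtain M where M: "\<forall>g\<in>G. \<forall>k\<ge>M. Y a k (g w') = 0"
    using truncation_uniform[of "(\<lambda>g. (a, g w')) ` G"] finite_G by auto
  \<comment> \<open>In the Jacobi identity with \<open>l = N\<close> the iterates vanish, which
    leaves weak commutativity; it is solved here for its term with \<open>i = 0\<close>.\<close>
  have swap: "Y (g w) p (Y a m (g w')) =
     (\<Sum>i\<le>N. scale ((- 1) ^ i * of_nat (N choose i) * (- 1) ^ N)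
         (Y a (m + int N - int i) (g (Y w (p - int N + int i) w'))))
     - (\<Sum>i\<in>{1..N}. scale ((- 1) ^ i * of_nat (N choose i)) (Y (g w) (p - int i) (Y a (m + int i) (g w'))))"
    if g: "g \<in> G" for g p m
  proof -
    let ?c = "\<lambda>i. (- 1) ^ i * of_nat (N choose i) :: complex"
    let ?f = "\<lambda>i. scale (?c i) (Y (g w) (p - int i) (Y a (m + int i) (g w')))"
    let ?h = "\<lambda>i. scale (?c i * (- 1) ^ N) (Y a (m + int N - int i) (Y (g w) (p - int N + int i) (g w')))"
    have "0 = Sum_any (\<lambda>i::nat. scale ((- 1) ^ i * (of_int (int N) gchoose i))
         (Y (g w) (p - int N + int N - int i) (Y a (m + int i) (g w'))
          - scale ((- 1) powi int N) (Y a (m + int N - int i) (Y (g w) (p - int N + int i) (g w')))))"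
      using Jacobi[of "p - int N" "g w" "int N" a m "g w'"] N[OF g] by (simp add: Y_left_simps)
    also have "\<dots> = Sum_any (\<lambda>i. ?f i - ?h i)"
      by (rule arg_cong[where f = Sum_any])
         (simp add: fun_eq_iff scale_right_diff_distrib binomial_gbinomial)
    also have "\<dots> = (\<Sum>i\<le>N. ?f i - ?h i)"
    proof (rule Sum_any.expand_superset)
      show "{i. ?f i - ?h i \<noteq> 0} \<subseteq> {..N}"
        by (rule subsetI, rule ccontr) (simp add: binomial_eq_0)
    qed simp
    also have "\<dots> = (\<Sum>i\<le>N. ?f i) - (\<Sum>i\<le>N. ?h i)"
      by (rule sum_subtractf)
    also have "(\<Sum>i\<le>N. ?f i) = ?f 0 + (\<Sum>i\<in>{1..N}. ?f i)"
      using sum.atLeast_Suc_atMost[of 0 N ?f] by (simp add: atMost_atLeast0)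
    finally show ?thesis
      by (simp add: G_Y[OF g] algebra_simps)
  qed
  show ?thesis
  \<comment> \<open>Each use of \<open>swap\<close> raises the mode index of \<open>a\<close> in the
    unswapped terms, and from \<open>M\<close> on these modes kill every
    \<open>g w'\<close>.\<close>
  proof (induction "nat (M - m)" arbitrary: m p rule: less_induct)
    case less
    show ?case
    proof (cases "m < M")
      case True
      show ?thesis
      proof (rule orbit_fun.agree[OF orbit_fun_diff swap])
        have "orbit_fun (\<lambda>g. Y a k (g (Y w j w')))" for k j
          by (rule orbit_fun.translate[OF Y_in_W[OF w] linear_right])
        then show "orbit_fun (\<lambda>g. \<Sum>i\<le>N. scale ((- 1) ^ i * of_nat (N choose i) * (- 1) ^ N)
            (Y a (m + int N - int i) (g (Y w (p - int N + int i) w'))))"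
          by (intro orbit_fun_sum orbit_fun_scale)
        show "orbit_fun (\<lambda>g. \<Sum>i\<in>{1..N}. scale ((- 1) ^ i * of_nat (N choose i))
            (Y (g w) (p - int i) (Y a (m + int i) (g w'))))"
          using True by (intro orbit_fun_sum orbit_fun_scale less) auto
      qed
    next
      case False
      show ?thesis
        by (rule orbit_fun.agree[OF orbit_fun_zero]) (use False M in \<open>auto simp: Y_right_simps\<close>)
    qed
  qed
qed

text \<open>Scalar coefficients are recorded through their action on \<open>orbit_fun\<close>, so
  closure under products is just composition.\<close>

definition multiplier :: "(('a \<Rightarrow> 'a) \<Rightarrow> complex) \<Rightarrow> bool" where
  "multiplier a \<longleftrightarrow> (\<forall>\<kappa>. orbit_fun \<kappa> \<longrightarrow> orbit_fun (\<lambda>g. scale (a g) (\<kappa> g)))"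

lemma multiplier_prod: "(\<And>i. i \<in> I \<Longrightarrow> multiplier (a i)) \<Longrightarrow> multiplier (\<lambda>g. \<Prod>i\<in>I. a i g)"
proof (induction I rule: infinite_finite_induct)
  case (insert i I)
  then show ?case
    by (simp add: multiplier_def flip: scale_scale)
qed (simp_all add: multiplier_def)

lemma multiplier_affine: "multiplier a \<Longrightarrow> multiplier (\<lambda>g. (a g - c) / d)"
proof -
  assume a: "multiplier a"
  have "orbit_fun (\<lambda>g. scale ((a g - c) / d) (\<kappa> g))" if \<kappa>: "orbit_fun \<kappa>" for \<kappa>
  proof -
    have "orbit_fun (\<lambda>g. scale (1 / d) (scale (a g) (\<kappa> g)) + scale (- c / d) (\<kappa> g))"
      using a \<kappa> by (intro orbit_fun.plus orbit_fun_scale) (auto simp: multiplier_def)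
    then show ?thesis
      by (rule orbit_fun.agree) (simp add: diff_divide_distrib scale_left_diff_distrib)
  qed
  then show ?thesis
    by (simp add: multiplier_def)
qed

text \<open>By density a mode sum \<open>b\<close> sends each \<open>g w'\<close> to
  \<open>f (g w')\<close> times \<open>vac\<close>. Applying \<open>Y (g w) (- 1)\<close> turns this
  into \<open>f (g w')\<close> times \<open>g w\<close> by creation, and
  \<open>orbit_fun_Y_Y\<close> shows that the result is an orbit function.\<close>

lemma multiplier_coefficient:
  assumes f: "Vector_Spaces.linear scale (*) f" and w': "w' \<in> W"
  shows "multiplier (\<lambda>g. f (g w'))"
proof -
  have lin: "Vector_Spaces.linear scale scale (\<lambda>x. scale (f x) vac)"
    using f by (simp add: Vector_Spaces.linear_iff scale_left_distrib)
  obtain b where b: "mode_sum b" "\<forall>x\<in>(\<lambda>g. g w') ` G. b x = scale (f x) vac"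
    using mode_sum_density[OF simple finite_imageI[OF finite_G] lin] by blast
  have "orbit_fun (\<lambda>g. scale (f (g w')) (\<kappa> g))" if "orbit_fun \<kappa>" for \<kappa>
    using that
  proof (induction rule: orbit_fun.induct)
    case (translate w T)
    have "orbit_fun (\<lambda>g. Y (g w) (- 1) (b (g w')))"
      using b(1)
    proof (induction rule: mode_sum.induct)
      case (mode u n)
      then show ?case
        by (rule orbit_fun_Y_Y[OF translate(1) w'])
    next
      case (add a b)
      then show ?case
        by (simp add: Y_right_simps orbit_fun.plus)
    qed
    then have "orbit_fun (\<lambda>g. scale (f (g w')) (g w))"
      by (rule orbit_fun.agree) (simp add: b(2) Y_right_simps creation)
    from orbit_fun_linear[OF translate(2) this] show ?case
      unfolding endo.linear_scale[OF translate(2)] .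
  next
    case (plus \<kappa> \<mu>)
    then show ?case
      by (simp add: scale_right_distrib orbit_fun.plus)
  next
    case (agree \<kappa> \<mu>)
    show ?case
      by (rule orbit_fun.agree[OF agree.IH]) (simp add: agree.hyps)
  qed
  then show ?thesis
    by (simp add: multiplier_def)
qed

section \<open>Recovering \<open>W\<close> from its pointwise stabiliser\<close>

definition stabiliser :: "('a \<Rightarrow> 'a) set" where
  "stabiliser = {g \<in> G. \<forall>w\<in>W. g w = w}"

text \<open>Matrix coefficients of \<open>W\<close> separate the stabiliser from every other element of \<open>G\<close>, so the
  indicator function of the stabiliser arises by interpolation.\<close>

lemma multiplier_stabiliser: "\<exists>a. multiplier a \<and> (\<forall>g\<in>G. a g = (if g \<in> stabiliser then 1 else 0))"
proof -
  interpret functional: vector_space_pair scale "(*) :: complex \<Rightarrow> complex \<Rightarrow> complex"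
    by unfold_locales (simp_all add: algebra_simps)
  have "\<exists>f w. w \<in> W \<and> Vector_Spaces.linear scale (*) f \<and> f (c w) \<noteq> f w" if c: "c \<in> G - stabiliser" for c
  proof -
    from c obtain w where w: "w \<in> W" "c w \<noteq> w"
      by (auto simp: stabiliser_def)
    then have "independent {c w - w}"
      by simp
    then obtain f where f: "Vector_Spaces.linear scale (*) f" "f (c w - w) = 1"
      using functional.linear_independent_extend[of "{c w - w}" "\<lambda>_. 1"] by auto
    then have "f (c w) \<noteq> f w"
      using functional.linear_diff[OF f(1)] by auto
    with w f show ?thesis
      by blast
  qed
  then obtain f w where fw: "\<And>c. c \<in> G - stabiliser \<Longrightarrow>
      w c \<in> W \<and> Vector_Spaces.linear scale (*) (f c) \<and> f c (c (w c)) \<noteq> f c (w c)"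
    by metis
  \<comment> \<open>As in Lagrange interpolation, the factor for \<open>c\<close> vanishes at
    \<open>g = c\<close>; it is 1 on the stabiliser, whose elements fix \<open>w c\<close>.\<close>
  let ?a = "\<lambda>g. \<Prod>c\<in>G - stabiliser. (f c (g (w c)) - f c (c (w c))) / (f c (w c) - f c (c (w c)))"
  have "multiplier ?a"
    using fw by (intro multiplier_prod multiplier_affine multiplier_coefficient) auto
  moreover have "?a g = 1" if "g \<in> stabiliser" for g
  proof (intro prod.neutral ballI)
    fix c assume c: "c \<in> G - stabiliser"
    have "g (w c) = w c"
      using that fw[OF c] by (simp add: stabiliser_def)
    then show "(f c (g (w c)) - f c (c (w c))) / (f c (w c) - f c (c (w c))) = 1"
      using fw[OF c] by (metis divide_self right_minus_eq)
  qed
  moreover have "?a g = 0" if "g \<in> G" "g \<notin> stabiliser" for g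
    using that finite_G by (intro prod_zero) auto
  ultimately show ?thesis
    by (intro exI[of _ ?a]) auto
qed

text \<open>As \<open>G\<close> fixes \<open>vac\<close>, a linear \<open>T\<close> with
  \<open>T vac = v\<close> gives the constant function \<open>v\<close>, which is then multiplied by
  the indicator.\<close>

lemma orbit_fun_stabiliser: "orbit_fun (\<lambda>g. if g \<in> stabiliser then v else 0)"
proof -
  obtain a where a: "multiplier a" "\<And>g. g \<in> G \<Longrightarrow> a g = (if g \<in> stabiliser then 1 else 0)"
    using multiplier_stabiliser by blast
  obtain T where T: "Vector_Spaces.linear scale scale T" "T vac = v"
    using endo.linear_independent_extend[of "{vac}" "\<lambda>_. v"] vac_nonzero by auto
  have "orbit_fun (\<lambda>g. scale (a g) (T (g vac)))"
    using a(1) orbit_fun.translate[OF vac_in_W T(1)] by (simp add: multiplier_def)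
  then show ?thesis
    by (rule orbit_fun.agree) (simp add: a(2) G_vac T(2))
qed

text \<open>For \<open>v\<close> fixed by the stabiliser, the average of its indicator times
  \<open>v\<close> is \<open>card stabiliser\<close> times \<open>v\<close>; this lies in
  \<open>W\<close>, and the factor is invertible.\<close>

lemma fixed_points_stabiliser: "fixed_points stabiliser = W"
proof
  show "W \<subseteq> fixed_points stabiliser"
    by (auto simp: stabiliser_def fixed_points_def)
  show "fixed_points stabiliser \<subseteq> W"
  proof
    fix v assume v: "v \<in> fixed_points stabiliser"
    have "inv_into UNIV g (if g \<in> stabiliser then v else 0) = (if g \<in> stabiliser then v else 0)"
      if "g \<in> G" for g
      using v that G_inv_simp(2)[OF that, of v] endo.linear_0[OF G_linear[OF inv_in_G[OF that]]]
      by (auto simp: fixed_points_def)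
    then have "(\<Sum>g\<in>G. inv_into UNIV g (if g \<in> stabiliser then v else 0))
        = (\<Sum>g\<in>G. if g \<in> stabiliser then v else 0)"
      by (intro sum.cong) auto
    also have "\<dots> = (\<Sum>g\<in>stabiliser. v)"
      using finite_G by (intro sum.mono_neutral_cong_right) (auto simp: stabiliser_def)
    also have "\<dots> = (\<Sum>g\<in>stabiliser. scale 1 v)"
      by simp
    also have "\<dots> = scale (of_nat (card stabiliser)) v"
      unfolding scale_sum_left[symmetric] by simp
    finally have "scale (of_nat (card stabiliser)) v \<in> W"
      using average_orbit_fun_in_W[OF orbit_fun_stabiliser] by metis
    then have "scale (inverse (of_nat (card stabiliser))) (scale (of_nat (card stabiliser)) v) \<in> W"
      by (rule subspace_scale[OF subspace_W])
    moreover have "card stabiliser \<noteq> 0"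
      using finite_G id_in_G by (auto simp: stabiliser_def)
    ultimately show "v \<in> W"
      by simp
  qed
qed

lemma subgroup_stabiliser: "subgroup stabiliser (Aut\<lparr>carrier := G\<rparr>)"
  unfolding subgroup_Aut_iff[OF subgroup_Aut]
proof (intro conjI ballI)
  fix f assume f: "f \<in> stabiliser"
  then have "f \<in> G"
    by (simp add: stabiliser_def)
  have "inv_into UNIV f w = w" if "w \<in> W" for w
    using G_inv_simp(2)[OF \<open>f \<in> G\<close>, of w] f that by (simp add: stabiliser_def)
  then show "inv_into UNIV f \<in> stabiliser"
    using inv_in_G[OF \<open>f \<in> G\<close>] by (simp add: stabiliser_def)
qed (auto simp: stabiliser_def id_in_G comp_in_G)

end

section \<open>Injectivity and the bijection\<close>

context finite_Aut_subgroup
begin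

lemma sub_VOA_fixed_points:
  assumes "H \<subseteq> G"
  shows "sub_VOA_containing (fixed_points G) (fixed_points H)"
proof -
  have lin: "Vector_Spaces.linear scale scale h" if "h \<in> H" for h
    using that assms G_linear by blast
  have "subspace (fixed_points H)"
    by (auto intro!: subspaceI simp: fixed_points_def endo.linear_0[OF lin] endo.linear_add[OF lin]
        endo.linear_scale[OF lin])
  moreover have "Y u n w \<in> fixed_points H" if "u \<in> fixed_points H" "w \<in> fixed_points H" for u n w
    using that assms G_Y by (fastforce simp: fixed_points_def)
  moreover have "fixed_points G \<subseteq> fixed_points H"
    using assms by (auto simp: fixed_points_def)
  ultimately show ?thesis
    by (simp add: sub_VOA_containing_def)
qed

text \<open>If \<open>g0\<close> fixes \<open>fixed_points H\<close>, then sums of orbit functions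
  over \<open>H\<close> and over the coset of \<open>g0\<close> agree. Testing this on a function
  supported at \<open>id\<close> shows that the coset contains \<open>id\<close>.\<close>

lemma subgroup_eq_fixing_fixed_points:
  assumes "subgroup H (Aut\<lparr>carrier := G\<rparr>)"
  shows "H = {g \<in> G. \<forall>v\<in>fixed_points H. g v = v}"
proof
  have H: "H \<subseteq> G" "id \<in> H" "\<And>f g. f \<in> H \<Longrightarrow> g \<in> H \<Longrightarrow> f \<circ> g \<in> H"
    "\<And>f. f \<in> H \<Longrightarrow> inv_into UNIV f \<in> H"
    using assms by (auto simp: subgroup_Aut_iff[OF subgroup_Aut])
  show "H \<subseteq> {g \<in> G. \<forall>v\<in>fixed_points H. g v = v}"
    using H(1) by (auto simp: fixed_points_def)
  \<comment> \<open>For \<open>W = UNIV\<close> the stabiliser is trivial, so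
    \<open>orbit_fun_stabiliser\<close> supplies the function supported at
    \<open>id\<close>.\<close>
  interpret whole: intermediate_VOA scale Y vac \<omega> G UNIV
    by unfold_locales (simp add: sub_VOA_containing_def)
  have stab: "whole.stabiliser = {id}"
    using id_in_G by (auto simp: whole.stabiliser_def)
  have "g0 \<in> H" if g0: "g0 \<in> G" "\<forall>v\<in>fixed_points H. g0 v = v" for g0
  proof -
    have inv: "(\<Sum>h\<in>H. \<kappa> (g0 \<circ> h)) = (\<Sum>h\<in>H. \<kappa> h)" if "whole.orbit_fun \<kappa>" for \<kappa>
      using that
    proof (induction rule: whole.orbit_fun.induct)
      case (translate w T)
      have "(\<Sum>h\<in>H. T ((g0 \<circ> h) w)) = T (g0 (\<Sum>h\<in>H. h w))"
        by (simp add: endo.linear_sum[OF translate(2)] endo.linear_sum[OF G_linear[OF g0(1)]])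
      also have "g0 (\<Sum>h\<in>H. h w) = (\<Sum>h\<in>H. h w)"
        using g0(2) sum_subgroup_fixed[OF H(1,3,4)] by blast
      finally show ?case
        by (simp add: endo.linear_sum[OF translate(2)])
    next
      case (plus \<kappa> \<mu>)
      then show ?case
        by (simp add: sum.distrib)
    next
      case (agree \<kappa> \<mu>)
      have "(\<Sum>h\<in>H. \<mu> (g0 \<circ> h)) = (\<Sum>h\<in>H. \<kappa> (g0 \<circ> h))"
        using g0(1) H(1) by (intro sum.cong refl agree.hyps(2) comp_in_G) auto
      also have "\<dots> = (\<Sum>h\<in>H. \<mu> h)"
        unfolding agree.IH using H(1) by (intro sum.cong refl agree.hyps(2)[symmetric]) auto
      finally show ?case .
    qed
    have "finite H"
      using H(1) finite_G finite_subset by blast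
    then have "(\<Sum>h\<in>H. if g0 \<circ> h = id then vac else 0) = vac"
      using inv[OF whole.orbit_fun_stabiliser[of vac]] H(2) by (simp add: stab)
    then have "(\<Sum>h\<in>H. if g0 \<circ> h = id then vac else 0) \<noteq> 0"
      using whole.vac_nonzero by simp
    then obtain h where h: "h \<in> H" "g0 \<circ> h = id"
      by (rule sum.not_neutral_contains_not_neutral) (auto split: if_splits)
    then have "h \<in> G"
      using H(1) by blast
    have "inv_into UNIV h = g0"
    proof
      fix x
      show "inv_into UNIV h x = g0 x"
        using fun_cong[OF h(2), of "inv_into UNIV h x"] G_inv_simp(1)[OF \<open>h \<in> G\<close>, of x] by simp
    qed
    then show "g0 \<in> H"
      using H(4)[OF h(1)] by simp
  qed
  then show "{g \<in> G. \<forall>v\<in>fixed_points H. g v = v} \<subseteq> H"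
    by blast
qed

text \<open>Taking the pointwise fixer in \<open>G\<close> is a left inverse, which gives
  injectivity; \<open>fixed_points_stabiliser\<close> gives surjectivity.\<close>

lemma Galois_correspondence:
  "bij_betw fixed_points {H. subgroup H (Aut\<lparr>carrier := G\<rparr>)}
     {W. sub_VOA_containing (fixed_points G) W}"
proof (rule bij_betw_imageI)
  show "inj_on fixed_points {H. subgroup H (Aut\<lparr>carrier := G\<rparr>)}"
    by (rule inj_on_inverseI[where g = "\<lambda>W. {g \<in> G. \<forall>v\<in>W. g v = v}"])
       (simp add: subgroup_eq_fixing_fixed_points[symmetric])
  have "W \<in> fixed_points ` {H. subgroup H (Aut\<lparr>carrier := G\<rparr>)}"
    if "sub_VOA_containing (fixed_points G) W" for W
  proof -
    interpret intermediate_VOA scale Y vac \<omega> G W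
      by unfold_locales (rule that)
    show ?thesis
      using fixed_points_stabiliser subgroup_stabiliser by blast
  qed
  then show "fixed_points ` {H. subgroup H (Aut\<lparr>carrier := G\<rparr>)} = {W. sub_VOA_containing (fixed_points G) W}"
    using sub_VOA_fixed_points subgroup_Aut_iff[OF subgroup_Aut] by auto
qed

end

theorem theorem2:
  fixes scale :: "complex \<Rightarrow> 'v::ab_group_add \<Rightarrow> 'v"
    and Y :: "'v \<Rightarrow> int \<Rightarrow> 'v \<Rightarrow> 'v"
    and vac \<omega> :: 'v
    and G :: "('v \<Rightarrow> 'v) set"
  assumes "vertex_operator_algebra scale Y vac \<omega>"
    and "vertex_operator_algebra.simple_VOA scale Y"
    and "subgroup G (vertex_operator_algebra.Aut scale Y vac \<omega>)"
    and "finite G"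
    and "nilpotent_group ((vertex_operator_algebra.Aut scale Y vac \<omega>)\<lparr>carrier := G\<rparr>)"
  shows "bij_betw fixed_points
           {H. subgroup H ((vertex_operator_algebra.Aut scale Y vac \<omega>)\<lparr>carrier := G\<rparr>)}
           {W. vertex_operator_algebra.sub_VOA_containing scale Y (fixed_points G) W} \<and>
         (\<forall>H K. subgroup H ((vertex_operator_algebra.Aut scale Y vac \<omega>)\<lparr>carrier := G\<rparr>) \<longrightarrow>
                subgroup K ((vertex_operator_algebra.Aut scale Y vac \<omega>)\<lparr>carrier := G\<rparr>) \<longrightarrow>
                H \<subseteq> K \<longrightarrow> fixed_points K \<subseteq> fixed_points H)"
proof -
  interpret vertex_operator_algebra scale Y vac \<omega>
    by fact
  interpret finite_Aut_subgroup scale Y vac \<omega> G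
    by (intro finite_Aut_subgroup.intro finite_Aut_subgroup_axioms.intro
        vertex_operator_algebra_axioms assms)
  show ?thesis
    using Galois_correspondence by (auto simp: fixed_points_def)
qed

end
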